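(* Let $n\ge2$. Then $$\Big(\bigcap_{\beta>0}L(\log L)^\beta(\mathbb{S}^{n-1})\Big)\setminus\Big(\bigcup_{\nu>-1,\ 1<q\le\infty}B_q^{0,\nu}(\mathbb{S}^{n-1})\Big)\ne\varnothing.$$
   Context: $\mathbb{S}^{n-1}$ is the unit sphere of $\mathbb{R}^n$ and $\sigma$ is the induced Lebesgue (surface) measure; $|M|=\sigma(M)$. Functions are complex-valued and identified when equal a.e. $\log^+t=\max\{\log t,0\}$ for $t>0$. A cap is a set $\{x\in\mathbb{S}^{n-1}:|x-x_0|<\rho\}$ with $x_0\in\mathbb{S}^{n-1}$, $\rho>0$ (an arc when $n=2$). For $1<q\le\infty$ let $1/q+1/q'=1$ (so $q'=1$ if $q=\infty$). A $q$-block is a measurable function $a$ on $\mathbb{S}^{n-1}$ supported in some cap $M$ with $\|a\|_{q}\le |M|^{-1/q'}$. For $\nu>-1$, the block space $B_q^{0,\nu}(\mathbb{S}^{n-1})$ is the set of all $\Omega\in L^1(\mathbb{S}^{n-1})$ that can be written as $\Omega=\sum_{j=1}^\infty\mu_ja_j$ (convergence in $L^1$), where $\mu_j\in\mathbb{C}$, each $a_j$ is a $q$-block supported in a cap $M_j$, and $$\sum_{j=1}^\infty|\mu_j|\Big\{1+\Big(\log^+\frac1{|M_j|}\Big)^{1+\nu}\Big\}<\infty.$$ For $\beta>0$, $L(\log L)^\beta(\mathbb{S}^{n-1})$ is the set of measurable $f$ with $\int_{\mathbb{S}^{n-1}}|f|(\log(e+|f|))^\beta d\sigma<\infty$. *)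

theory Defs
  imports "HOL-Analysis.Analysis" "HOL-Probability.Essential_Supremum"
begin

text \<open>
  Surface measure on the unit sphere of an \<open>n\<close>-dimensional Euclidean space, by polar coordinates:
  a Borel set \<open>A\<close> gets \<open>n\<close> times the Lebesgue measure of the cone
  \<open>{r *\<^sub>R x | r x. 0 < r \<and> r \<le> 1 \<and> x \<in> A}\<close> (see \<open>emeasure_borel_surface\<close> below), which is the
  unique normalisation with \<open>dx = r ^ (n - 1) dr d\<sigma>\<close>.
\<close>

definition borel_surface :: "'a::euclidean_space measure" where
  "borel_surface = scale_measure (of_nat DIM('a))
     (distr (restrict_space lborel (cball 0 1 - {0})) (restrict_space borel (sphere 0 1))
       (\<lambda>x. x /\<^sub>R norm x))"

definition surface :: "'a::euclidean_space measure" where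
  "surface = completion borel_surface"

definition cap :: "'a::euclidean_space \<Rightarrow> real \<Rightarrow> 'a set" where
  "cap x0 \<rho> = {x \<in> sphere 0 1. norm (x - x0) < \<rho>}"

definition is_cap :: "'a::euclidean_space set \<Rightarrow> bool" where
  "is_cap M \<longleftrightarrow> (\<exists>x0 \<rho>. x0 \<in> sphere 0 1 \<and> \<rho> > 0 \<and> M = cap x0 \<rho>)"

definition Lq_norm :: "ennreal \<Rightarrow> ('a::euclidean_space \<Rightarrow> complex) \<Rightarrow> ennreal" where
  "Lq_norm q f =
    (if q = \<infinity> then esssup surface (\<lambda>x. ennreal (norm (f x)))
     else let I = \<integral>\<^sup>+x. ennreal (norm (f x) powr enn2real q) \<partial>surface
          in if I = \<infinity> then \<infinity> else ennreal (enn2real I powr (1 / enn2real q)))"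

definition conj_exponent :: "ennreal \<Rightarrow> ennreal" where
  "conj_exponent q = inverse (1 - inverse q)"

definition log_plus :: "real \<Rightarrow> real" where
  "log_plus t = max (ln t) 0"

text \<open>
  Functions are identified when they agree almost everywhere, so the support condition is imposed
  almost everywhere.  Values off the sphere are irrelevant throughout.
\<close>

definition is_block :: "ennreal \<Rightarrow> 'a::euclidean_space set \<Rightarrow> ('a \<Rightarrow> complex) \<Rightarrow> bool" where
  "is_block q M a \<longleftrightarrow>
     is_cap M \<and> a \<in> borel_measurable surface \<and>
     (AE x in surface. x \<notin> M \<longrightarrow> a x = 0) \<and>
     Lq_norm q a \<le> ennreal (measure surface M powr (- enn2real (inverse (conj_exponent q))))"

definition block_space :: "ennreal \<Rightarrow> real \<Rightarrow> ('a::euclidean_space \<Rightarrow> complex) set" where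
  "block_space q \<nu> =
    {\<Omega>. integrable surface \<Omega> \<and>
       (\<exists>(\<mu> :: nat \<Rightarrow> complex) a M.
          (\<forall>j. is_block q (M j) (a j)) \<and>
          (\<lambda>N. \<integral>\<^sup>+x. ennreal (norm (\<Omega> x - (\<Sum>j<N. \<mu> j * a j x))) \<partial>surface)
            \<longlonglongrightarrow> 0 \<and>
          summable (\<lambda>j. norm (\<mu> j) *
            (1 + log_plus (1 / measure surface (M j)) powr (1 + \<nu>))))}"

definition LlogL :: "real \<Rightarrow> ('a::euclidean_space \<Rightarrow> complex) set" where
  "LlogL \<beta> =
    {f. f \<in> borel_measurable surface \<and>
        (\<integral>\<^sup>+x. ennreal (norm (f x) * ln (exp 1 + norm (f x)) powr \<beta>) \<partial>surface) < \<infinity>}"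

lemma conj_exponent:
  assumes "1 < q"
  shows "inverse q + inverse (conj_exponent q) = 1"
proof -
  have "inverse q \<le> 1"
    using assms by (cases q) (auto simp: inverse_ennreal ennreal_less_iff ennreal_le_iff field_simps simp flip: ennreal_1)
  moreover have "inverse (inverse x) = x" for x :: ennreal
  proof (cases x)
    case (real r)
    then show ?thesis by (cases "r = 0") (auto simp: inverse_ennreal)
  qed simp
  ultimately show ?thesis
    by (simp add: conj_exponent_def)
qed

lemma space_surface [simp]: "space surface = sphere 0 1"
  by (simp add: surface_def borel_surface_def space_scale_measure space_restrict_space)

lemma measurable_radial_projection:
  "(\<lambda>x. x /\<^sub>R norm x) \<in>
     measurable (restrict_space lborel (cball 0 1 - {0})) (restrict_space borel (sphere (0::'a::euclidean_space) 1))"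
  by (rule measurable_restrict_space3) auto

lemma emeasure_borel_surface:
  fixes A :: "'a::euclidean_space set"
  assumes "A \<in> sets borel" "A \<subseteq> sphere 0 1"
  shows "emeasure borel_surface A =
    of_nat DIM('a) * emeasure lborel {r *\<^sub>R x | r x. 0 < r \<and> r \<le> 1 \<and> x \<in> A}"
proof -
  have "(\<lambda>x. x /\<^sub>R norm x) -` A \<inter> (cball 0 1 - {0}) = {r *\<^sub>R x | r x. 0 < r \<and> r \<le> 1 \<and> x \<in> A}"
    (is "?L = ?R")
  proof (intro set_eqI iffI)
    fix x assume x: "x \<in> ?L"
    then have "x = norm x *\<^sub>R (x /\<^sub>R norm x)" by simp
    with x show "x \<in> ?R" by (smt (verit) DiffE IntE insertCI mem_Collect_eq mem_cball_0 vimageE zero_less_norm_iff)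
  next
    fix x assume "x \<in> ?R"
    then obtain r y where r: "x = r *\<^sub>R y" "0 < r" "r \<le> 1" "y \<in> A" by auto
    with assms have "norm y = 1" by auto
    with r show "x \<in> ?L" by auto
  qed
  moreover have "A \<in> sets (restrict_space borel (sphere 0 1))"
    using assms by (auto simp: sets_restrict_space_iff)
  moreover from calculation have "?R \<subseteq> cball 0 1 - {0}" by blast
  ultimately show ?thesis
    by (simp add: borel_surface_def emeasure_distr[OF measurable_radial_projection]
        space_restrict_space emeasure_restrict_space)
qed

end

theory Submission
  imports Defs "HOL-Real_Asymp.Real_Asymp"
begin

text \<open>
  The function is \<open>f = (SUP k. 2 ^ - k * exp (k\<^sup>2) * indicator (E k))\<close>, where \<open>E k\<close> has relative measure
  \<open>exp (- k\<^sup>2)\<close> and is spread out so evenly that every cap of measure at least \<open>exp (- exp (k\<^sup>2))\<close>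
  contains at most twice its share of \<open>E k\<close>.  Then \<open>f\<close> lies in every \<open>L (log L) ^ \<beta>\<close> because
  \<open>2 ^ - k * k ^ (2 * \<beta>)\<close> is summable.  For a block in a large cap, Hoelder's inequality makes the
  integral over \<open>E k\<close> at most of order \<open>exp (- k\<^sup>2 / q')\<close>; a block in a smaller cap pays the weight
  \<open>exp (k\<^sup>2 * (1 + \<nu>))\<close>.  So membership in a block space would bound the integral of \<open>f\<close> over \<open>E k\<close>,
  which is at least of order \<open>2 ^ - k\<close>, by a multiple of \<open>exp (- \<epsilon> * k\<^sup>2)\<close> for some \<open>\<epsilon> > 0\<close>.
\<close>

section \<open>Negligible circular cones\<close>

text \<open>The cone over the boundary of a cap lies in such a set. For \<open>0 \<le> t < 1\<close>
  the set is part of the frontier of a convex cone, and such frontiers are negligible. For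
  \<open>t \<ge> 1\<close> the equality case of Cauchy-Schwarz confines it to the line through
  \<open>x\<close>, negligible in dimension at least 2. A negative \<open>t\<close> becomes positive
  on passing to \<open>- x\<close>.\<close>

lemma negligible_circular_cone:
  fixes x :: "'a::euclidean_space"
  assumes "2 \<le> DIM('a)" "norm x = 1"
  shows "negligible {y. y \<bullet> x = t * norm y}"
proof -
  have nonneg: "negligible {y. y \<bullet> x = t * norm y}" if "norm x = 1" "0 \<le> t" for x :: 'a and t
  proof (cases "t < 1")
    case True
    let ?C = "{y. t * norm y \<le> y \<bullet> x}"
    have "convex ?C"
    proof (rule convexI)
      fix y z :: 'a and u v :: real
      assume *: "y \<in> ?C" "z \<in> ?C" "0 \<le> u" "0 \<le> v" "u + v = 1"
      have "t * norm (u *\<^sub>R y + v *\<^sub>R z) \<le> t * (u * norm y + v * norm z)"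
        using * \<open>0 \<le> t\<close> by (intro mult_left_mono norm_triangle_le) auto
      also have "\<dots> = u * (t * norm y) + v * (t * norm z)"
        by (simp add: algebra_simps)
      also have "\<dots> \<le> u * (y \<bullet> x) + v * (z \<bullet> x)"
        using * by (intro add_mono mult_left_mono) auto
      finally show "u *\<^sub>R y + v *\<^sub>R z \<in> ?C"
        by (simp add: inner_add_left)
    qed
    moreover have "{y. y \<bullet> x = t * norm y} \<subseteq> frontier ?C"
    proof
      fix y assume y: "y \<in> {y. y \<bullet> x = t * norm y}"
      have "y \<notin> interior ?C"
      proof
        assume "y \<in> interior ?C"
        then obtain e where e: "e > 0" "ball y e \<subseteq> ?C"
          by (auto simp: mem_interior)
        \<comment> \<open>Moving from \<open>y\<close> by \<open>e / 2\<close> against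
          \<open>x\<close> lowers \<open>y \<bullet> x\<close> by \<open>e / 2\<close> but
          \<open>t * norm y\<close> by at most \<open>t * e / 2\<close>, which is less because
          \<open>t < 1\<close>. As equality holds at \<open>y\<close>, the moved point leaves
          \<open>?C\<close>.\<close>
        have "y - (e/2) *\<^sub>R x \<in> ball y e"
          using e that by (simp add: dist_norm)
        with e have "t * norm (y - (e/2) *\<^sub>R x) \<le> (y - (e/2) *\<^sub>R x) \<bullet> x"
          by blast
        also have "\<dots> = t * norm y - e / 2"
          using y that by (simp add: inner_diff_left dot_square_norm)
        finally have "t * norm (y - (e/2) *\<^sub>R x) \<le> t * norm y - e / 2" .
        moreover have "norm y - e / 2 \<le> norm (y - (e/2) *\<^sub>R x)"
          using norm_triangle_ineq2[of y "(e/2) *\<^sub>R x"] e that by simp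
        then have "t * (norm y - e / 2) \<le> t * norm (y - (e/2) *\<^sub>R x)"
          using that by (intro mult_left_mono)
        ultimately have "e / 2 * (1 - t) \<le> 0"
          by (simp add: algebra_simps)
        with e True show False
          by (simp add: mult_le_0_iff)
      qed
      moreover have "y \<in> closure ?C"
        using y by (intro subsetD[OF closure_subset]) simp
      ultimately show "y \<in> frontier ?C"
        by (simp add: frontier_def)
    qed
    ultimately show ?thesis
      using negligible_convex_frontier negligible_subset by blast
  next
    case False
    have "{y. y \<bullet> x = t * norm y} \<subseteq> span {x}"
    proof
      fix y assume "y \<in> {y. y \<bullet> x = t * norm y}"
      then have "norm y \<le> y \<bullet> x"
        using False by (simp add: mult_le_cancel_right1)
      moreover have "y \<bullet> x \<le> norm y"
        using norm_cauchy_schwarz[of y x] that by simp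
      ultimately have "y \<bullet> x = norm y * norm x"
        using that by simp
      then have "norm y *\<^sub>R x = y"
        using norm_cauchy_schwarz_eq[of y x] that by simp
      then show "y \<in> span {x}"
        by (metis span_base span_mul singletonI)
    qed
    moreover have "dim (span {x}) < DIM('a)"
      using assms dim_singleton[of x] by simp
    ultimately show ?thesis
      using negligible_lowdim negligible_subset by blast
  qed
  show ?thesis
  proof (cases "0 \<le> t")
    case True
    then show ?thesis using nonneg assms by blast
  next
    case False
    have "{y. y \<bullet> x = t * norm y} = {y. y \<bullet> (- x) = (- t) * norm y}"
      by auto
    then show ?thesis
      using nonneg[of "- x" "- t"] assms False by simp
  qed
qed

section \<open>Surface measure: total mass, caps, null boundaries\<close>

lemma sets_surfaceI:
  assumes "A \<in> sets borel" "A \<subseteq> sphere 0 1"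
  shows "A \<in> sets surface"
  using assms by (auto simp: surface_def borel_surface_def sets_restrict_space_iff)

lemma emeasure_surface:
  fixes A :: "'a::euclidean_space set"
  assumes "A \<in> sets borel" "A \<subseteq> sphere 0 1"
  shows "emeasure surface A =
    of_nat DIM('a) * emeasure lborel {r *\<^sub>R x | r x. 0 < r \<and> r \<le> 1 \<and> x \<in> A}"
  using assms emeasure_borel_surface[OF assms]
  by (auto simp: surface_def borel_surface_def sets_restrict_space_iff)

lemma emeasure_surface_sphere:
  "emeasure (surface :: 'a::euclidean_space measure) (sphere 0 1) =
     ennreal (DIM('a) * unit_ball_vol (DIM('a)))"
proof -
  have "{r *\<^sub>R x | r x. 0 < r \<and> r \<le> 1 \<and> x \<in> sphere 0 1} = cball 0 1 - {0 :: 'a}" (is "?L = ?R")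
  proof
    show "?R \<subseteq> ?L"
    proof
      fix y assume y: "y \<in> ?R"
      then have "y = norm y *\<^sub>R (y /\<^sub>R norm y)" by simp
      with y show "y \<in> ?L"
        by (intro CollectI exI[of _ "norm y"] exI[of _ "y /\<^sub>R norm y"]) auto
    qed
  qed auto
  moreover have "emeasure lborel (cball 0 1 - {0 :: 'a}) = emeasure lborel (cball 0 1 :: 'a set)"
    by (subst emeasure_Diff) auto
  ultimately show ?thesis
    by (simp add: emeasure_surface emeasure_cball ennreal_mult ennreal_of_nat_eq_real_of_nat)
qed

interpretation surface: finite_measure "surface :: 'a::euclidean_space measure"
  by standard (simp add: emeasure_surface_sphere)

lemma measure_surface_sphere_pos: "0 < measure (surface :: 'a::euclidean_space measure) (sphere 0 1)"
  by (simp add: measure_def emeasure_surface_sphere)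

lemma sets_cap [measurable, simp]: "cap x \<rho> \<in> sets surface"
proof (rule sets_surfaceI)
  have "cap x \<rho> = sphere 0 1 \<inter> ball x \<rho>"
    by (auto simp: cap_def dist_norm norm_minus_commute)
  then show "cap x \<rho> \<in> sets borel" by simp
qed (auto simp: cap_def)

text \<open>Unit vectors at distance \<open>\<rho>\<close> have inner product
  \<open>1 - \<rho>\<^sup>2 / 2\<close>, so the cone over this part of the sphere lies in a
  negligible circular cone. In dimension 1 the sphere consists of two atoms and the claim would
  fail.\<close>

lemma AE_surface_dist_noteq:
  fixes x :: "'a::euclidean_space"
  assumes "2 \<le> DIM('a)" "norm x = 1"
  shows "AE y in surface. norm (y - x) \<noteq> \<rho>"
proof -
  let ?A = "sphere 0 1 \<inter> sphere x \<rho>"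
  let ?N = "{y. y \<bullet> x = (1 - \<rho>\<^sup>2 / 2) * norm y}"
  have "y \<bullet> x = 1 - \<rho>\<^sup>2 / 2" if "y \<in> ?A" for y
    using that assms by (auto simp: dist_norm norm_minus_commute dot_norm_neg)
  then have "{r *\<^sub>R y | r y. 0 < r \<and> r \<le> 1 \<and> y \<in> ?A} \<subseteq> ?N"
    by (auto simp: dist_norm)
  moreover have "?N \<in> null_sets lebesgue"
    using negligible_circular_cone[OF assms] by (simp add: negligible_iff_null_sets)
  moreover have "?N \<in> sets borel"
    by measurable
  ultimately have "emeasure lborel {r *\<^sub>R y | r y. 0 < r \<and> r \<le> 1 \<and> y \<in> ?A} \<le> 0"
    using emeasure_mono[of _ ?N lborel] by (auto simp: null_sets_def)
  then have "emeasure surface ?A = 0"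
    by (simp add: emeasure_surface)
  then have "?A \<in> null_sets surface"
    by (auto intro!: sets_surfaceI)
  then show ?thesis
    by (rule AE_I') (auto simp: dist_norm norm_minus_commute)
qed


section \<open>Thin annuli and continuity of the measure in the radius\<close>

text \<open>Compactness gives the uniformity in centre and radius. Otherwise there are annuli of
  width \<open>1 / Suc m\<close> and measure at least \<open>\<kappa>\<close>; along a subsequence
  their centres and radii converge, and the indicators tend to 0 off the null set at the limiting
  distance from the limiting centre. Dominated convergence then contradicts the lower bound
  \<open>\<kappa>\<close>.\<close>

lemma uniformly_small_annuli:
  assumes "2 \<le> DIM('a::euclidean_space)" "0 < \<kappa>"
  obtains r where "0 < r"
    "\<And>(x::'a) \<rho>. norm x = 1 \<Longrightarrow> measure surface {y \<in> sphere 0 1. \<rho> \<le> norm (y - x) \<and> norm (y - x) < \<rho> + r} < \<kappa>"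
proof -
  define A where "A r x \<rho> = {y \<in> sphere 0 1. \<rho> \<le> norm (y - x) \<and> norm (y - x) < \<rho> + r}" for r \<rho> and x :: 'a
  have A_sets [measurable]: "A r x \<rho> \<in> sets surface" for r x \<rho>
  proof (rule sets_surfaceI)
    have "A r x \<rho> = sphere 0 1 \<inter> (ball x (\<rho> + r) - ball x \<rho>)"
      by (auto simp: A_def dist_norm norm_minus_commute)
    then show "A r x \<rho> \<in> sets borel" by simp
  qed (auto simp: A_def)
  have "\<exists>r>0. \<forall>x \<rho>. norm x = 1 \<longrightarrow> measure surface (A r x \<rho>) < \<kappa>"
  proof (rule ccontr)
    assume "\<not> ?thesis"
    then have "\<forall>m. \<exists>x \<rho>. norm x = 1 \<and> \<kappa> \<le> measure surface (A (1 / Suc m) x \<rho>)"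
      by (metis not_le zero_less_divide_1_iff of_nat_0_less_iff zero_less_Suc)
    then obtain x \<rho> where x: "\<And>m. norm (x m) = 1" and \<kappa>: "\<And>m. \<kappa> \<le> measure surface (A (1 / Suc m) (x m) (\<rho> m))"
      by metis
    \<comment> \<open>The annulus has positive measure, hence contains a point; its distance from
      the centre is in \<open>{0..2}\<close>, and the width is at most 1.\<close>
    have "\<rho> m \<in> {-1..2}" for m
    proof -
      have "A (1 / Suc m) (x m) (\<rho> m) \<noteq> {}"
        using \<kappa>[of m] \<open>0 < \<kappa>\<close> by auto
      then obtain y where y: "norm y = 1" "\<rho> m \<le> norm (y - x m)" "norm (y - x m) < \<rho> m + 1 / Suc m"
        by (auto simp: A_def)
      moreover have "norm (y - x m) \<le> 2"
        using norm_triangle_ineq4[of y "x m"] y x by simp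
      moreover have "1 / Suc m \<le> 1"
        by simp
      ultimately show ?thesis
        using norm_ge_zero[of "y - x m"] by (simp only: atLeastAtMost_iff) linarith
    qed
    then have xs: "\<forall>m. (x m, \<rho> m) \<in> sphere 0 1 \<times> {-1..2}"
      using x by simp
    have sc: "seq_compact (sphere (0::'a) 1 \<times> {-1..2::real})"
      by (intro compact_imp_seq_compact compact_Times) auto
    obtain l s where l: "l \<in> sphere 0 1 \<times> {-1..2}" "strict_mono (s :: nat \<Rightarrow> nat)"
        and lim: "((\<lambda>m. (x m, \<rho> m)) \<circ> s) \<longlonglongrightarrow> l"
      by (rule seq_compactE[OF sc, of "\<lambda>m. (x m, \<rho> m)"]) (use xs in auto)
    obtain x' \<rho>' where l': "l = (x', \<rho>')" by (cases l)
    have xlim: "(\<lambda>m. x (s m)) \<longlonglongrightarrow> x'" and \<rho>lim: "(\<lambda>m. \<rho> (s m)) \<longlonglongrightarrow> \<rho>'"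
      using tendsto_fst[OF lim] tendsto_snd[OF lim] by (simp_all add: l' o_def)
    have slim: "(\<lambda>m. \<rho> (s m) + 1 / Suc (s m)) \<longlonglongrightarrow> \<rho>' + 0"
      using LIMSEQ_subseq_LIMSEQ[OF LIMSEQ_inverse_real_of_nat l(2)]
      by (intro tendsto_add \<rho>lim) (simp add: o_def inverse_eq_divide)
    define B where "B m = A (1 / Suc (s m)) (x (s m)) (\<rho> (s m))" for m
    have [measurable]: "B m \<in> sets surface" for m
      by (simp add: B_def)
    have B_sphere: "B m \<inter> sphere 0 1 = B m" for m
      by (auto simp: B_def A_def)
    have "(\<lambda>m. integral\<^sup>L surface (indicator (B m) :: 'a \<Rightarrow> real)) \<longlonglongrightarrow> integral\<^sup>L surface (\<lambda>_ :: 'a. 0 :: real)"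
    proof (rule integral_dominated_convergence[where w = "\<lambda>_. 1"])
      have "norm x' = 1" using l l' by simp
      from AE_surface_dist_noteq[OF assms(1) this, of \<rho>']
      show "AE y in surface. (\<lambda>m. indicator (B m) y :: real) \<longlonglongrightarrow> 0"
      proof eventually_elim
        case (elim y)
        have ylim: "(\<lambda>m. norm (y - x (s m))) \<longlonglongrightarrow> norm (y - x')"
          by (intro tendsto_intros xlim)
        \<comment> \<open>If \<open>y\<close> is closer to \<open>x'\<close> than
          \<open>\<rho>'\<close>, it eventually lies inside the inner radius; if it is farther away,
          it eventually lies beyond the outer radius, which has the same limit.\<close>
        have "eventually (\<lambda>m. y \<notin> B m) sequentially"
        proof (cases "norm (y - x') < \<rho>'")
          case True
          have "eventually (\<lambda>m. norm (y - x (s m)) < \<rho> (s m)) sequentially"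
            using order_tendstoD(2)[OF tendsto_diff[OF ylim \<rho>lim], of 0] True by simp
          then show ?thesis by eventually_elim (auto simp: B_def A_def)
        next
          case False
          with elim have "\<rho>' + 0 < norm (y - x')" by simp
          have "eventually (\<lambda>m. \<rho> (s m) + 1 / Suc (s m) < norm (y - x (s m))) sequentially"
            using order_tendstoD(2)[OF tendsto_diff[OF slim ylim], of 0] \<open>\<rho>' + 0 < norm (y - x')\<close> by simp
          then show ?thesis by eventually_elim (auto simp: B_def A_def)
        qed
        then have "eventually (\<lambda>m. indicator (B m) y = (0::real)) sequentially"
          by eventually_elim simp
        then show ?case by (rule tendsto_eventually)
      qed
    qed (auto simp: indicator_def)
    then have "(\<lambda>m. measure surface (B m)) \<longlonglongrightarrow> 0"
      by (simp add: B_sphere)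
    then have "\<kappa> \<le> 0"
      using \<kappa> by (intro LIMSEQ_le_const) (auto simp only: B_def)
    with \<open>0 < \<kappa>\<close> show False by simp
  qed
  then show thesis
    using that by (auto simp: A_def)
qed

lemma cap_mono: "s \<le> t \<Longrightarrow> cap x s \<subseteq> cap x t"
  by (auto simp: cap_def)

text \<open>Enlarging the radius by less than \<open>r\<close> adds only points of an annulus of
  width \<open>r\<close>, whose measure is below any prescribed \<open>e\<close>.\<close>

lemma continuous_on_measure_Int_cap:
  fixes x :: "'a::euclidean_space"
  assumes "2 \<le> DIM('a)" "norm x = 1" and P [measurable]: "P \<in> sets surface"
  shows "continuous_on UNIV (\<lambda>\<rho>. measure surface (P \<inter> cap x \<rho>))"
proof -
  let ?m = "\<lambda>\<rho>. measure surface (P \<inter> cap x \<rho>)"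
  have "\<exists>d>0. \<forall>\<rho>'. dist \<rho>' \<rho> < d \<longrightarrow> dist (?m \<rho>') (?m \<rho>) < e" if e: "0 < e" for \<rho> e :: real
  proof -
    from uniformly_small_annuli[OF assms(1) e] obtain r where r: "0 < r"
      "\<And>(x::'a) \<rho>. norm x = 1 \<Longrightarrow> measure surface {y \<in> sphere 0 1. \<rho> \<le> norm (y - x) \<and> norm (y - x) < \<rho> + r} < e"
      by blast
    have step: "?m s \<le> ?m t \<and> ?m t < ?m s + e" if "s \<le> t" "t < s + r" for s t
    proof
      show "?m s \<le> ?m t"
        using cap_mono[OF that(1), of x] by (intro surface.finite_measure_mono) auto
      let ?A = "{y \<in> sphere 0 1. s \<le> norm (y - x) \<and> norm (y - x) < s + r}"
      have A: "?A = cap x (s + r) - cap x s"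
        by (auto simp: cap_def)
      have "?m t \<le> measure surface (P \<inter> cap x s \<union> ?A)"
        using cap_mono[of t "s + r" x] that unfolding A by (intro surface.finite_measure_mono) auto
      also have "\<dots> \<le> ?m s + measure surface ?A"
        unfolding A by (intro measure_Un_le) auto
      also have "\<dots> < ?m s + e"
        using r(2)[OF assms(2)] by simp
      finally show "?m t < ?m s + e" .
    qed
    have "dist (?m \<rho>') (?m \<rho>) < e" if "dist \<rho>' \<rho> < r" for \<rho>'
      using step[of \<rho> \<rho>'] step[of \<rho>' \<rho>] that by (cases "\<rho> \<le> \<rho>'") (auto simp: dist_real_def)
    with r(1) show ?thesis by blast
  qed
  then show ?thesis
    by (simp add: continuous_on_iff)
qed

text \<open>Intermediate value theorem between radius 0, where the cap is empty, and radius 3, which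
  exceeds the diameter of the sphere.\<close>

lemma measure_Int_cap_eq:
  fixes x :: "'a::euclidean_space"
  assumes "2 \<le> DIM('a)" "norm x = 1" "P \<in> sets surface" "0 \<le> \<eta>" "\<eta> \<le> 1"
  obtains \<rho> where "measure surface (P \<inter> cap x \<rho>) = \<eta> * measure surface P"
proof -
  have "norm (y - x) < 3" if "norm y = 1" for y
    using norm_triangle_ineq4[of y x] that assms(2) by simp
  then have "cap x 3 = sphere 0 1"
    by (auto simp: cap_def)
  moreover have "P \<subseteq> sphere 0 1"
    using sets.sets_into_space[OF assms(3)] by simp
  ultimately have "P \<inter> cap x 3 = P" "P \<inter> cap x 0 = {}"
    by (auto simp: cap_def)
  then have "\<exists>\<rho>\<ge>0. \<rho> \<le> 3 \<and> measure surface (P \<inter> cap x \<rho>) = \<eta> * measure surface P"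
    using assms continuous_on_subset[OF continuous_on_measure_Int_cap[OF assms(1-3)]]
    by (intro IVT') (auto intro: mult_left_le_one_le)
  then show thesis using that by blast
qed

section \<open>Sets spread evenly over the sphere\<close>

text \<open>Total boundedness covers the sphere by finitely many balls of radius
  \<open>r / 2\<close>, which are then made disjoint.\<close>

lemma small_sphere_partition:
  assumes "0 < r"
  obtains P :: "nat \<Rightarrow> 'a::euclidean_space set" and n where
    "range P \<subseteq> sets surface" "disjoint_family P" "(\<Union>i<n. P i) = sphere 0 1"
    "\<forall>i. \<forall>x\<in>P i. \<forall>y\<in>P i. norm (x - y) < r"
proof -
  obtain C where C: "finite C" "sphere (0::'a) 1 \<subseteq> (\<Union>x\<in>C. ball x (r / 2))"
    using compact_sphere[of "0::'a" 1] half_gt_zero[OF assms] unfolding compact_eq_totally_bounded by blast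
  then obtain c where c: "bij_betw c {0..<card C} C"
    using ex_bij_betw_nat_finite by blast
  \<comment> \<open>Nothing is known of \<open>c i\<close> for \<open>i \<ge> card C\<close>, but
    every \<open>A i\<close> lies in a ball of radius \<open>r / 2\<close>, so the diameter bound
    holds for all indices.\<close>
  define A where "A i = sphere 0 1 \<inter> ball (c i) (r / 2)" for i
  define P where "P = disjointed A"
  have A_sets: "A i \<in> sets surface" for i
    by (rule sets_surfaceI) (auto simp: A_def)
  show thesis
  proof
    show "range P \<subseteq> sets surface"
      using sets.range_disjointed_sets[of A surface] A_sets by (auto simp: P_def)
    show "disjoint_family P"
      by (simp add: P_def disjoint_family_disjointed)
    have "(\<Union>i<card C. P i) = (\<Union>i\<in>{0..<card C}. A i)"
      using finite_UN_disjointed_eq[of A "card C"] by (simp add: P_def atLeast0LessThan)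
    also have "\<dots> = sphere 0 1 \<inter> (\<Union>x\<in>c ` {0..<card C}. ball x (r / 2))"
      by (auto simp: A_def)
    finally show "(\<Union>i<card C. P i) = sphere 0 1"
      using C c by (simp only: bij_betw_def) blast
    show "\<forall>i. \<forall>x\<in>P i. \<forall>y\<in>P i. norm (x - y) < r"
    proof (intro allI ballI)
      fix i x y assume "x \<in> P i" "y \<in> P i"
      then have "dist (c i) x < r / 2" "dist (c i) y < r / 2"
        using disjointed_subset[of A i] by (auto simp: P_def A_def)
      then show "norm (x - y) < r"
        using dist_triangle_half_r[of "c i" x r y] by (simp add: dist_norm)
    qed
  qed
qed

text \<open>
  \<open>E\<close> takes the proportion \<open>\<eta>\<close> of every cell of a fine partition; the cells that meet a cap lie in a
  slightly larger cap, whose measure exceeds that of the original one by less than \<open>\<kappa>\<close>.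
\<close>

lemma evenly_spread_set:
  assumes "2 \<le> DIM('a::euclidean_space)" "0 < \<eta>" "\<eta> \<le> 1" "0 < \<kappa>"
  obtains E :: "'a::euclidean_space set" where "E \<in> sets surface" "measure surface E = \<eta> * measure surface (sphere (0::'a) 1)"
    "\<And>M. is_cap M \<Longrightarrow> \<kappa> \<le> measure surface M \<Longrightarrow> measure surface (E \<inter> M) \<le> 2 * \<eta> * measure surface M"
proof -
  from uniformly_small_annuli[OF assms(1) \<open>0 < \<kappa>\<close>] obtain r where r: "0 < r"
    "\<And>(x::'a) \<rho>. norm x = 1 \<Longrightarrow> measure surface {y \<in> sphere 0 1. \<rho> \<le> norm (y - x) \<and> norm (y - x) < \<rho> + r} < \<kappa>"
    by blast
  obtain P :: "nat \<Rightarrow> 'a set" and n where P_sets: "range P \<subseteq> sets surface"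
    and P': "disjoint_family P" "(\<Union>i<n. P i) = sphere 0 1"
      "\<forall>i. \<forall>x\<in>P i. \<forall>y\<in>P i. norm (x - y) < r"
    using small_sphere_partition[OF \<open>0 < r\<close>] by blast
  have P [measurable]: "P i \<in> sets surface" for i
    using P_sets by blast
  \<comment> \<open>One centre \<open>b\<close> serves all cells; only the radius that cuts off the
    proportion \<open>\<eta>\<close> depends on the cell.\<close>
  obtain b :: 'a where b: "norm b = 1"
    using vector_choose_size[of 1] by auto
  have "\<exists>\<rho>. measure surface (P i \<inter> cap b \<rho>) = \<eta> * measure surface (P i)" for i
    using measure_Int_cap_eq[OF assms(1) b P[of i], of \<eta>] assms by auto
  then obtain \<rho> where \<rho>: "\<And>i. measure surface (P i \<inter> cap b (\<rho> i)) = \<eta> * measure surface (P i)"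
    by metis
  define Q where "Q i = P i \<inter> cap b (\<rho> i)" for i
  have [measurable]: "Q i \<in> sets surface" for i
    by (simp add: Q_def)
  have sum_Q: "measure surface (\<Union>i\<in>I. Q i) = \<eta> * measure surface (\<Union>i\<in>I. P i)" if "finite I" for I
  proof -
    have "disjoint_family_on P I" "disjoint_family_on Q I"
      using P'(1) by (auto simp: disjoint_family_on_def Q_def)
    then have "measure surface (\<Union>i\<in>I. Q i) = (\<Sum>i\<in>I. measure surface (Q i))"
      "measure surface (\<Union>i\<in>I. P i) = (\<Sum>i\<in>I. measure surface (P i))"
      using that by (auto intro!: surface.finite_measure_finite_Union)
    then show ?thesis
      by (simp add: Q_def \<rho> sum_distrib_left)
  qed
  show thesis
  proof
    show "(\<Union>i<n. Q i) \<in> sets surface"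
      by auto
    show "measure surface (\<Union>i<n. Q i) = \<eta> * measure surface (sphere (0::'a) 1)"
      by (simp add: sum_Q P'(2))
    fix M :: "'a set" assume M: "is_cap M" "\<kappa> \<le> measure surface M"
    then obtain x s where x: "norm x = 1" "M = cap x s"
      by (auto simp: is_cap_def)
    define I where "I = {i \<in> {..<n}. P i \<inter> M \<noteq> {}}"
    let ?A = "{y \<in> sphere 0 1. s \<le> norm (y - x) \<and> norm (y - x) < s + r}"
    have A: "?A = cap x (s + r) - cap x s"
      by (auto simp: cap_def)
    have "(\<Union>i\<in>I. P i) \<subseteq> M \<union> ?A"
    proof
      fix y assume "y \<in> (\<Union>i\<in>I. P i)"
      then obtain i z where i: "i < n" "y \<in> P i" "z \<in> P i" "z \<in> M"
        by (auto simp: I_def)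
      have "norm (y - x) \<le> norm (y - z) + norm (z - x)"
        using norm_triangle_ineq[of "y - z" "z - x"] by simp
      moreover have "norm (y - z) < r" "norm (z - x) < s"
        using i P'(3) x by (auto simp: cap_def)
      moreover have "y \<in> sphere 0 1"
        using sets.sets_into_space[OF P[of i]] i by auto
      ultimately show "y \<in> M \<union> ?A"
        using x by (auto simp: cap_def)
    qed
    have "measure surface ((\<Union>i<n. Q i) \<inter> M) \<le> measure surface (\<Union>i\<in>I. Q i)"
      by (intro surface.finite_measure_mono) (auto simp: I_def Q_def)
    also have "\<dots> = \<eta> * measure surface (\<Union>i\<in>I. P i)"
      by (intro sum_Q) (simp add: I_def)
    also have "\<dots> \<le> \<eta> * measure surface (M \<union> ?A)"
      using assms \<open>(\<Union>i\<in>I. P i) \<subseteq> M \<union> ?A\<close> unfolding A x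
      by (intro mult_left_mono surface.finite_measure_mono) auto
    also have "\<dots> \<le> \<eta> * (measure surface M + measure surface ?A)"
      using assms unfolding A x by (intro mult_left_mono measure_Un_le) auto
    \<comment> \<open>The annulus has measure below \<open>\<kappa>\<close>, hence below that of
      \<open>M\<close>; this is the source of the factor 2.\<close>
    also have "\<dots> \<le> \<eta> * (measure surface M + measure surface M)"
      using assms r(2)[OF x(1), of s] M by (intro mult_left_mono add_left_mono) auto
    finally show "measure surface ((\<Union>i<n. Q i) \<inter> M) \<le> 2 * \<eta> * measure surface M"
      by simp
  qed
qed



section \<open>Integrals of a single block\<close>

lemma inverse_conj_exponent:
  assumes "1 < q"
  shows "enn2real (inverse (conj_exponent q)) = (if q = \<infinity> then 1 else 1 - 1 / enn2real q)"
proof (cases q)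
  case (real r)
  with assms have r: "1 < r"
    by (simp flip: ennreal_1 add: ennreal_less_iff)
  then have "conj_exponent q = inverse (ennreal (1 - 1 / r))"
    using real by (simp add: conj_exponent_def inverse_ennreal inverse_eq_divide ennreal_minus flip: ennreal_1)
  also have "\<dots> = ennreal (inverse (1 - 1 / r))"
    using r by (simp add: inverse_ennreal)
  also have "inverse \<dots> = ennreal (1 - 1 / r)"
    using r by (simp add: inverse_ennreal)
  finally show ?thesis
    using r real by simp
qed (simp add: conj_exponent_def)

text \<open>This exponent \<open>1 / q'\<close> governs the decay of the bound for blocks in large
  caps; it would be 0 for \<open>q = 1\<close>.\<close>

lemma inverse_conj_exponent_pos:
  assumes "1 < q"
  shows "0 < enn2real (inverse (conj_exponent q))"
proof (cases q)
  case (real r)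
  with assms have "1 < r"
    by (simp flip: ennreal_1 add: ennreal_less_iff)
  then show ?thesis
    using assms real by (simp add: inverse_conj_exponent)
qed (use assms in \<open>simp add: inverse_conj_exponent\<close>)

text \<open>Integrated and optimised over \<open>s\<close>, this gives Hoelder's inequality up to a factor 2.\<close>

lemma le_add_powr:
  fixes u s r :: real
  assumes "0 \<le> u" "0 < s" "1 < r"
  shows "u \<le> s + s powr (1 - r) * u powr r"
proof (cases "u \<le> s")
  case True
  then show ?thesis using assms by (simp add: add_increasing2)
next
  case False
  then have "u = u powr (1 - r) * u powr r"
    using assms by (simp flip: powr_add)
  also have "\<dots> \<le> s powr (1 - r) * u powr r"
    using False assms by (intro mult_right_mono powr_mono2') auto
  finally show ?thesis using assms by simp
qed

text \<open>Hoelder's inequality bounds the integral by the \<open>q\<close>-norm of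
  \<open>a\<close> times the measure of \<open>E \<inter> M\<close> to the power
  \<open>1 / q'\<close>; the powers of the measure of \<open>M\<close> cancel. With
  \<open>\<theta> = 1\<close> this also bounds the full mass of a block.\<close>

lemma block_set_nn_integral_le:
  assumes q: "1 < q" and a: "is_block q M a" and E [measurable]: "E \<in> sets surface"
    and \<theta>: "0 < \<theta>" "measure surface (E \<inter> M) \<le> \<theta> * measure surface M"
  shows "(\<integral>\<^sup>+x\<in>E. ennreal (norm (a x)) \<partial>surface)
    \<le> ennreal (2 * \<theta> powr enn2real (inverse (conj_exponent q)))"
proof -
  define \<gamma> where "\<gamma> = enn2real (inverse (conj_exponent q))"
  define m where "m = measure surface M"
  have [measurable]: "M \<in> sets surface" "a \<in> borel_measurable surface"
    using a by (auto simp: is_block_def is_cap_def)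
  have supp: "AE x in surface. x \<notin> M \<longrightarrow> a x = 0"
    and norm_a: "Lq_norm q a \<le> ennreal (m powr (- \<gamma>))"
    using a by (auto simp: is_block_def m_def \<gamma>_def)
  show ?thesis
  \<comment> \<open>If \<open>M\<close> is null, then \<open>a\<close> vanishes almost everywhere by
    its support. The case is split off because the rest divides by \<open>m\<close>.\<close>
  proof (cases "m = 0")
    case True
    then have "M \<in> null_sets surface"
      by (simp add: m_def null_sets_def surface.emeasure_eq_measure)
    then have "AE x in surface. x \<notin> M"
      by (rule AE_not_in)
    with supp have "AE x in surface. ennreal (norm (a x)) * indicator E x = 0"
      by eventually_elim simp
    then have "(\<integral>\<^sup>+x\<in>E. ennreal (norm (a x)) \<partial>surface) = 0"
      by (subst nn_integral_0_iff_AE) auto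
    then show ?thesis by simp
  next
    case False
    then have m: "0 < m"
      by (simp add: m_def zero_less_measure_iff)
    have EM: "emeasure surface (E \<inter> M) \<le> ennreal (\<theta> * m)"
      using \<theta> by (simp add: m_def surface.emeasure_eq_measure)
    show ?thesis
    proof (cases "q = \<infinity>")
      case True
      then have \<gamma>: "\<gamma> = 1"
        using q by (simp add: \<gamma>_def inverse_conj_exponent)
      have "AE x in surface. ennreal (norm (a x)) \<le> esssup surface (\<lambda>x. ennreal (norm (a x)))"
        by (rule esssup_AE)
      with supp have "AE x in surface. ennreal (norm (a x)) * indicator E x \<le> ennreal (1 / m) * indicator (E \<inter> M) x"
      proof eventually_elim
        case (elim x)
        then have "ennreal (norm (a x)) \<le> ennreal (1 / m)"
          using order_trans[OF elim(2), of "ennreal (1 / m)"] norm_a True \<gamma> m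
          by (simp add: Lq_norm_def powr_minus_divide del: ennreal_le_iff)
        then show ?case
          using elim by (auto simp: indicator_def)
      qed
      then have "(\<integral>\<^sup>+x\<in>E. ennreal (norm (a x)) \<partial>surface) \<le> (\<integral>\<^sup>+x. ennreal (1 / m) * indicator (E \<inter> M) x \<partial>surface)"
        by (rule nn_integral_mono_AE)
      also have "\<dots> = ennreal (1 / m) * emeasure surface (E \<inter> M)"
        by (subst nn_integral_cmult_indicator) auto
      also have "\<dots> \<le> ennreal (1 / m) * ennreal (\<theta> * m)"
        by (intro mult_left_mono EM) simp
      also have "\<dots> = ennreal \<theta>"
        using m \<theta> by (simp flip: ennreal_mult)
      also have "\<dots> \<le> ennreal (2 * \<theta> powr \<gamma>)"
        using \<theta> \<gamma> by (intro ennreal_leI) simp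
      finally show ?thesis by (simp add: \<gamma>_def)
    next
      case False
      define r where "r = enn2real q"
      have "q = ennreal r"
        using False by (simp add: r_def less_top)
      with q have r: "1 < r"
        by (simp flip: ennreal_1 add: ennreal_less_iff)
      have \<gamma>: "\<gamma> = 1 - 1 / r"
        using q False by (simp add: \<gamma>_def inverse_conj_exponent r_def)
      define J where "J = (\<integral>\<^sup>+x. ennreal (norm (a x) powr r) \<partial>surface)"
      have J: "J \<noteq> \<infinity>" "enn2real J powr (1 / r) \<le> m powr (- \<gamma>)"
        using norm_a False by (auto simp: Lq_norm_def J_def Let_def r_def top_unique split: if_splits)
      \<comment> \<open>Raising the norm condition to the power \<open>r\<close> gives the exponent
        \<open>1 - r\<close>, because \<open>\<gamma> * r = r - 1\<close>.\<close>
      have "enn2real J = (enn2real J powr (1 / r)) powr r"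
        using r by (simp add: powr_powr)
      also have "\<dots> \<le> (m powr (- \<gamma>)) powr r"
        using J r by (intro powr_mono2) auto
      also have "\<dots> = m powr (1 - r)"
        using r by (simp add: powr_powr \<gamma> algebra_simps)
      finally have "J \<le> ennreal (m powr (1 - r))"
        using J by (metis ennreal_enn2real ennreal_leI infinity_ennreal_def less_top)
      \<comment> \<open>This threshold balances the two terms of \<open>le_add_powr\<close> after
        integration: each becomes \<open>\<theta> powr \<gamma>\<close>.\<close>
      define s where "s = \<theta> powr (- 1 / r) / m"
      have s: "0 < s"
        using m \<theta> by (simp add: s_def)
      have "AE x in surface. ennreal (norm (a x)) * indicator E x \<le>
        ennreal s * indicator (E \<inter> M) x + ennreal (s powr (1 - r)) * ennreal (norm (a x) powr r)"
        using supp
      proof eventually_elim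
        case (elim x)
        have "ennreal (norm (a x)) \<le> ennreal (s + s powr (1 - r) * norm (a x) powr r)"
          using s r by (intro ennreal_leI le_add_powr) auto
        also have "\<dots> = ennreal s + ennreal (s powr (1 - r)) * ennreal (norm (a x) powr r)"
          using s by (simp add: ennreal_mult)
        finally show ?case
          using elim by (auto simp: indicator_def)
      qed
      then have "(\<integral>\<^sup>+x\<in>E. ennreal (norm (a x)) \<partial>surface) \<le>
        (\<integral>\<^sup>+x. ennreal s * indicator (E \<inter> M) x + ennreal (s powr (1 - r)) * ennreal (norm (a x) powr r) \<partial>surface)"
        by (rule nn_integral_mono_AE)
      also have "\<dots> = ennreal s * emeasure surface (E \<inter> M) + ennreal (s powr (1 - r)) * J"
        unfolding J_def by (subst nn_integral_add) (auto simp: nn_integral_cmult nn_integral_cmult_indicator)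
      also have "\<dots> \<le> ennreal s * ennreal (\<theta> * m) + ennreal (s powr (1 - r)) * ennreal (m powr (1 - r))"
        by (intro add_mono mult_left_mono EM \<open>J \<le> _\<close>) auto
      also have "\<dots> = ennreal (s * (\<theta> * m) + s powr (1 - r) * m powr (1 - r))"
        using s m \<theta> by (simp flip: ennreal_mult ennreal_plus)
      also have "s * (\<theta> * m) = \<theta> powr \<gamma>"
        using m \<theta> powr_add[of \<theta> "- 1 / r" 1] by (simp add: s_def \<gamma>)
      also have "s powr (1 - r) * m powr (1 - r) = (\<theta> powr (- 1 / r)) powr (1 - r)"
        using m by (simp add: s_def powr_divide)
      also have "- 1 / r * (1 - r) = \<gamma>"
        using r by (simp add: \<gamma> field_simps)
      then have "(\<theta> powr (- 1 / r)) powr (1 - r) = \<theta> powr \<gamma>"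
        by (simp only: powr_powr)
      finally show ?thesis by (simp add: \<gamma>_def)
    qed
  qed
qed

section \<open>Integrals of functions in a block space\<close>

text \<open>Every block contributes at most twice its weight times the bracket on the right: blocks
  in large caps through the first summand, blocks in small caps through the second. So
  \<open>C\<close> is twice the sum in the definition of the space; it depends only on the chosen
  decomposition, which allows \<open>E\<close>, \<open>\<theta>\<close> and \<open>\<kappa>\<close>
  to vary afterwards.\<close>

lemma block_space_set_nn_integral_le:
  assumes q: "1 < q" and \<nu>: "- 1 < \<nu>" and \<Omega>: "\<Omega> \<in> block_space q \<nu>"
  obtains C where "0 \<le> C" "\<forall>E \<theta> \<kappa>. E \<in> sets surface \<longrightarrow> 0 < \<theta> \<longrightarrow> 0 < \<kappa> \<longrightarrow> \<kappa> < 1 \<longrightarrow>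
    (\<forall>M. is_cap M \<longrightarrow> \<kappa> \<le> measure surface M \<longrightarrow> measure surface (E \<inter> M) \<le> \<theta> * measure surface M) \<longrightarrow>
    (\<integral>\<^sup>+x\<in>E. ennreal (norm (\<Omega> x)) \<partial>surface)
      \<le> ennreal (C * (\<theta> powr enn2real (inverse (conj_exponent q)) + ln (1 / \<kappa>) powr (- (1 + \<nu>))))"
proof -
  define \<gamma> where "\<gamma> = enn2real (inverse (conj_exponent q))"
  obtain \<mu> a M where block: "\<And>j. is_block q (M j) (a j)"
    and lim: "(\<lambda>N. \<integral>\<^sup>+x. ennreal (norm (\<Omega> x - (\<Sum>j<N. \<mu> j * a j x))) \<partial>surface) \<longlonglongrightarrow> 0"
    and sum: "summable (\<lambda>j. norm (\<mu> j) * (1 + log_plus (1 / measure surface (M j)) powr (1 + \<nu>)))"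
    and [measurable]: "\<Omega> \<in> borel_measurable surface"
    using \<Omega> unfolding block_space_def by (auto dest: borel_measurable_integrable)
  have [measurable]: "a j \<in> borel_measurable surface" for j
    using block by (simp add: is_block_def)
  define w where "w j = 1 + log_plus (1 / measure surface (M j)) powr (1 + \<nu>)" for j
  have w1: "1 \<le> w j" for j by (simp add: w_def)
  define C where "C = 2 * (\<Sum>j. norm (\<mu> j) * w j)"
  have sum_w: "summable (\<lambda>j. norm (\<mu> j) * w j)"
    using sum by (simp add: w_def)
  have nonneg: "0 \<le> norm (\<mu> j) * w j" for j
    using w1[of j] by simp
  show thesis
  proof
    show "0 \<le> C"
      using suminf_nonneg[OF sum_w nonneg] by (simp add: C_def)
  next
    show "\<forall>E \<theta> \<kappa>. E \<in> sets surface \<longrightarrow> 0 < \<theta> \<longrightarrow> 0 < \<kappa> \<longrightarrow> \<kappa> < 1 \<longrightarrow>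
      (\<forall>M. is_cap M \<longrightarrow> \<kappa> \<le> measure surface M \<longrightarrow> measure surface (E \<inter> M) \<le> \<theta> * measure surface M) \<longrightarrow>
      (\<integral>\<^sup>+x\<in>E. ennreal (norm (\<Omega> x)) \<partial>surface)
        \<le> ennreal (C * (\<theta> powr enn2real (inverse (conj_exponent q)) + ln (1 / \<kappa>) powr (- (1 + \<nu>))))"
    proof (intro allI impI)
      fix E :: "'a set" and \<theta> \<kappa> :: real
      assume E [measurable]: "E \<in> sets surface" and \<theta>: "0 < \<theta>" and \<kappa>: "0 < \<kappa>" "\<kappa> < 1"
        and spread: "\<forall>M. is_cap M \<longrightarrow> \<kappa> \<le> measure surface M \<longrightarrow> measure surface (E \<inter> M) \<le> \<theta> * measure surface M"
      define B where "B = \<theta> powr \<gamma> + ln (1 / \<kappa>) powr (- (1 + \<nu>))"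
      have B: "0 \<le> B" "\<theta> powr \<gamma> \<le> B" "ln (1 / \<kappa>) powr (- (1 + \<nu>)) \<le> B"
        by (auto simp: B_def)
      have a_le: "(\<integral>\<^sup>+x\<in>E. ennreal (norm (a j x)) \<partial>surface) \<le> ennreal (2 * w j * B)" for j
      proof -
        have cap: "is_cap (M j)"
          using block by (simp add: is_block_def)
        then have [measurable]: "M j \<in> sets surface"
          by (auto simp: is_cap_def)
        have mono: "measure surface (E \<inter> M j) \<le> measure surface (M j)"
          by (intro surface.finite_measure_mono) auto
        have "(\<integral>\<^sup>+x\<in>E. ennreal (norm (a j x)) \<partial>surface) \<le> ennreal (2 * \<theta> powr \<gamma>)"
          if "measure surface (E \<inter> M j) \<le> \<theta> * measure surface (M j)"
          unfolding \<gamma>_def by (rule block_set_nn_integral_le[OF q block E \<theta> that])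
        moreover have "2 * \<theta> powr \<gamma> \<le> 2 * w j * B"
          using mult_mono[OF w1[of j] B(2)] w1[of j] by simp
        ultimately have *: ?thesis if "measure surface (E \<inter> M j) \<le> \<theta> * measure surface (M j)"
          using that by (meson ennreal_leI order_trans)
        \<comment> \<open>Null caps are separated from small ones: as \<open>1 / 0 = 0\<close>,
          their weight does not reflect smallness. They satisfy the spreading inequality
          trivially.\<close>
        consider "\<kappa> \<le> measure surface (M j)" | "measure surface (M j) = 0"
          | "0 < measure surface (M j)" "measure surface (M j) < \<kappa>"
          using zero_less_measure_iff[of surface "M j"] by linarith
        then show ?thesis
        proof cases
          case 1
          then show ?thesis using spread cap * by blast
        next
          case 2
          then show ?thesis using mono by (intro *) simp
        next
          case 3
          let ?L = "ln (1 / \<kappa>)"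
          have L: "0 < ?L" using \<kappa> by simp
          \<comment> \<open>For a small cap the weight is at least
            \<open>?L powr (1 + \<nu>)\<close>, so the second summand of \<open>B\<close> makes
            \<open>w j * B\<close> at least 1, and the crude bound 2 for the mass of the block
            suffices.\<close>
          have "?L \<le> log_plus (1 / measure surface (M j))"
            using 3 \<kappa> by (auto simp: log_plus_def field_simps intro!: max.coboundedI1)
          then have "?L powr (1 + \<nu>) \<le> log_plus (1 / measure surface (M j)) powr (1 + \<nu>)"
            using L \<nu> by (intro powr_mono2) auto
          then have "?L powr (1 + \<nu>) \<le> w j"
            by (simp add: w_def)
          then have "?L powr (1 + \<nu>) * ?L powr (- (1 + \<nu>)) \<le> w j * B"
            using B w1[of j] by (intro mult_mono) auto
          then have "1 \<le> w j * B"
            using L by (simp flip: powr_add)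
          have "(\<integral>\<^sup>+x\<in>E. ennreal (norm (a j x)) \<partial>surface) \<le> ennreal (2 * 1 powr \<gamma>)"
            unfolding \<gamma>_def by (rule block_set_nn_integral_le[OF q block E]) (use mono in auto)
          also have "\<dots> \<le> ennreal (2 * w j * B)"
            using \<open>1 \<le> w j * B\<close> by (intro ennreal_leI) simp
          finally show ?thesis .
        qed
      qed
      \<comment> \<open>\<open>\<Omega>\<close> is compared with a partial sum: the bound
        \<open>C * B\<close> does not depend on \<open>N\<close>, and the error \<open>?D N\<close>
        tends to 0.\<close>
      let ?D = "\<lambda>N. \<integral>\<^sup>+x. ennreal (norm (\<Omega> x - (\<Sum>j<N. \<mu> j * a j x))) \<partial>surface"
      have "(\<integral>\<^sup>+x\<in>E. ennreal (norm (\<Omega> x)) \<partial>surface) \<le> ?D N + ennreal (C * B)" for N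
      proof -
        have "ennreal (norm (\<Omega> x)) * indicator E x \<le> ennreal (norm (\<Omega> x - (\<Sum>j<N. \<mu> j * a j x)))
          + (\<Sum>j<N. ennreal (norm (\<mu> j)) * (ennreal (norm (a j x)) * indicator E x))" for x
        proof (cases "x \<in> E")
          case True
          have "norm (\<Omega> x) \<le> norm (\<Omega> x - (\<Sum>j<N. \<mu> j * a j x)) + norm (\<Sum>j<N. \<mu> j * a j x)"
            using norm_triangle_ineq[of "\<Omega> x - (\<Sum>j<N. \<mu> j * a j x)" "\<Sum>j<N. \<mu> j * a j x"] by simp
          also have "norm (\<Sum>j<N. \<mu> j * a j x) \<le> (\<Sum>j<N. norm (\<mu> j) * norm (a j x))"
            by (rule sum_norm_le) (simp add: norm_mult)
          finally have "ennreal (norm (\<Omega> x)) \<le> ennreal (norm (\<Omega> x - (\<Sum>j<N. \<mu> j * a j x)) + (\<Sum>j<N. norm (\<mu> j) * norm (a j x)))"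
            by (simp add: ennreal_leI)
          then show ?thesis
            using True by (simp add: sum_nonneg flip: ennreal_mult)
        qed simp
        then have "(\<integral>\<^sup>+x\<in>E. ennreal (norm (\<Omega> x)) \<partial>surface) \<le>
          (\<integral>\<^sup>+x. ennreal (norm (\<Omega> x - (\<Sum>j<N. \<mu> j * a j x)))
            + (\<Sum>j<N. ennreal (norm (\<mu> j)) * (ennreal (norm (a j x)) * indicator E x)) \<partial>surface)"
          by (intro nn_integral_mono)
        also have "\<dots> = ?D N + (\<Sum>j<N. ennreal (norm (\<mu> j)) * (\<integral>\<^sup>+x\<in>E. ennreal (norm (a j x)) \<partial>surface))"
          by (simp add: nn_integral_add nn_integral_sum nn_integral_cmult)
        also have "\<dots> \<le> ?D N + (\<Sum>j<N. ennreal (norm (\<mu> j)) * ennreal (2 * w j * B))"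
          by (intro add_mono sum_mono mult_left_mono a_le) auto
        also have "(\<Sum>j<N. ennreal (norm (\<mu> j)) * ennreal (2 * w j * B)) = ennreal (2 * B * (\<Sum>j<N. norm (\<mu> j) * w j))"
          using B order_trans[OF zero_le_one w1] by (simp add: sum_distrib_left mult_ac flip: ennreal_mult)
        also have "\<dots> \<le> ennreal (C * B)"
          using B sum_le_suminf[OF sum_w finite_lessThan nonneg]
          by (intro ennreal_leI) (simp add: C_def mult_left_mono mult_ac)
        finally show ?thesis by (simp add: add_left_mono)
      qed
      moreover have "(\<lambda>N. ?D N + ennreal (C * B)) \<longlonglongrightarrow> 0 + ennreal (C * B)"
        by (intro tendsto_add lim tendsto_const)
      ultimately have "(\<integral>\<^sup>+x\<in>E. ennreal (norm (\<Omega> x)) \<partial>surface) \<le> 0 + ennreal (C * B)"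
        by (intro LIMSEQ_le_const) auto
      then show "(\<integral>\<^sup>+x\<in>E. ennreal (norm (\<Omega> x)) \<partial>surface)
        \<le> ennreal (C * (\<theta> powr enn2real (inverse (conj_exponent q)) + ln (1 / \<kappa>) powr (- (1 + \<nu>))))"
        by (simp add: B_def \<gamma>_def)
    qed
  qed
qed


section \<open>The function outside all block spaces\<close>

text \<open>The threshold is doubly exponential so that its logarithm \<open>exp (k\<^sup>2)\<close>
  still yields a power of \<open>exp (- k\<^sup>2)\<close> in the bound for small caps.\<close>

lemma exists_spread_sequence:
  assumes "2 \<le> DIM('a::euclidean_space)"
  obtains E :: "nat \<Rightarrow> 'a::euclidean_space set" where "\<And>k. E k \<in> sets surface"
    "\<And>k. measure surface (E k) = exp (- (real k)\<^sup>2) * measure surface (sphere (0::'a) 1)"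
    "\<And>k M. is_cap M \<Longrightarrow> exp (- exp ((real k)\<^sup>2)) \<le> measure surface M \<Longrightarrow>
      measure surface (E k \<inter> M) \<le> 2 * exp (- (real k)\<^sup>2) * measure surface M"
proof -
  have "\<exists>E :: 'a set. E \<in> sets surface \<and>
    measure surface E = exp (- (real k)\<^sup>2) * measure surface (sphere (0::'a) 1) \<and>
    (\<forall>M. is_cap M \<longrightarrow> exp (- exp ((real k)\<^sup>2)) \<le> measure surface M \<longrightarrow>
      measure surface (E \<inter> M) \<le> 2 * exp (- (real k)\<^sup>2) * measure surface M)" for k
    using evenly_spread_set[OF assms, of "exp (- (real k)\<^sup>2)" "exp (- exp ((real k)\<^sup>2))"]
    by (metis exp_gt_zero exp_le_one_iff neg_le_0_iff_le zero_le_power2)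
  then obtain E :: "nat \<Rightarrow> 'a set" where "\<forall>k. E k \<in> sets surface \<and>
    measure surface (E k) = exp (- (real k)\<^sup>2) * measure surface (sphere (0::'a) 1) \<and>
    (\<forall>M. is_cap M \<longrightarrow> exp (- exp ((real k)\<^sup>2)) \<le> measure surface M \<longrightarrow>
      measure surface (E k \<inter> M) \<le> 2 * exp (- (real k)\<^sup>2) * measure surface M)"
    by metis
  then show thesis using that by blast
qed

lemma ennreal_le_suminf: "f k \<le> (\<Sum>k. f k)" for f :: "nat \<Rightarrow> ennreal"
  using sum_le_suminf[of f "{k}"] by (simp add: summableI)

text \<open>The sets \<open>E k\<close> and heights \<open>c k\<close> involve none of
  \<open>\<beta>\<close>, \<open>\<nu>\<close> and \<open>q\<close>, so one function serves all
  parameters.\<close>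

lemma LlogL_minus_block_space_nonempty:
  assumes "2 \<le> DIM('a::euclidean_space)"
  obtains f :: "'a::euclidean_space \<Rightarrow> complex" where "\<And>\<beta>. 0 < \<beta> \<Longrightarrow> f \<in> LlogL \<beta>"
    "\<And>\<nu> q. - 1 < \<nu> \<Longrightarrow> 1 < q \<Longrightarrow> f \<notin> block_space q \<nu>"
proof -
  define S where "S = measure (surface :: 'a measure) (sphere 0 1)"
  have S: "0 < S" using measure_surface_sphere_pos by (simp add: S_def)
  obtain E :: "nat \<Rightarrow> 'a set" where E [measurable]: "\<And>k. E k \<in> sets surface"
    and mE: "\<And>k. measure surface (E k) = exp (- (real k)\<^sup>2) * S"
    and spread: "\<And>k M. is_cap M \<Longrightarrow> exp (- exp ((real k)\<^sup>2)) \<le> measure surface M \<Longrightarrow>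
      measure surface (E k \<inter> M) \<le> 2 * exp (- (real k)\<^sup>2) * measure surface M"
    unfolding S_def using exists_spread_sequence[OF assms] by blast
  \<comment> \<open>The mass of \<open>c k\<close> on \<open>E k\<close> is
    \<open>(1 / 2) ^ k * S\<close>: summable even against powers of \<open>k\<close>, yet far larger
    than \<open>exp (- \<epsilon> * k\<^sup>2)\<close>.\<close>
  define c where "c k = (1 / 2) ^ k * exp ((real k)\<^sup>2)" for k
  have c_nonneg: "0 \<le> c k" for k by (simp add: c_def)
  have cE: "ennreal (c k) * emeasure surface (E k) = ennreal ((1 / 2) ^ k * S)" for k
    using S by (simp add: surface.emeasure_eq_measure mE c_def exp_minus flip: ennreal_mult)
  \<comment> \<open>The \<open>E k\<close> may overlap. With a supremum, a finite nonzero value is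
    at most twice a single \<open>c k\<close> with \<open>x \<in> E k\<close>, which bounds
    nonlinear functions of it termwise.\<close>
  define F where "F x = (SUP k. ennreal (c k) * indicator (E k) x)" for x
  have [measurable]: "F \<in> borel_measurable surface"
    unfolding F_def by measurable
  have c_le_F: "ennreal (c k) * indicator (E k) x \<le> F x" for k x
    unfolding F_def by (intro SUP_upper) simp
  \<comment> \<open>\<open>enn2real\<close> sends infinite values to 0; they form a null set because
    \<open>F\<close> has finite integral.\<close>
  define f where "f x = complex_of_real (enn2real (F x))" for x
  have [measurable]: "f \<in> borel_measurable surface"
    unfolding f_def by measurable
  have "(\<integral>\<^sup>+x. F x \<partial>surface) \<le> (\<integral>\<^sup>+x. (\<Sum>k. ennreal (c k) * indicator (E k) x) \<partial>surface)"
    unfolding F_def by (intro nn_integral_mono SUP_least ennreal_le_suminf)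
  also have "\<dots> = (\<Sum>k. ennreal ((1 / 2) ^ k * S))"
    by (simp add: nn_integral_suminf nn_integral_cmult_indicator cE)
  also have "\<dots> < \<infinity>"
    using S by (subst suminf_ennreal2) (auto intro!: summable_mult2 summable_geometric)
  finally have "AE x in surface. F x \<noteq> \<infinity>"
    by (intro nn_integral_noteq_infinite) auto
  then have F_eq: "AE x in surface. F x = ennreal (norm (f x))"
    by eventually_elim (simp add: f_def less_top)
  show thesis
  proof
    fix \<beta> :: real assume "0 < \<beta>"
    define \<Phi> where "\<Phi> t = t * ln (exp 1 + t) powr \<beta>" for t :: real
    have \<Phi>_mono: "\<Phi> s \<le> \<Phi> t" if "0 \<le> s" "s \<le> t" for s t
    proof -
      have "1 \<le> exp 1 + s" using that exp_ge_one_plus_x_over_n_power_n[of 1 1] by (simp add: add_increasing2)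
      then show ?thesis
        using that \<open>0 < \<beta>\<close> unfolding \<Phi>_def by (intro mult_mono powr_mono2) auto
    qed
    have "ennreal (\<Phi> (norm (f x))) \<le> (\<Sum>k. ennreal (\<Phi> (2 * c k)) * indicator (E k) x)" for x
    proof (cases "f x = 0")
      case True
      then show ?thesis by (simp add: \<Phi>_def)
    next
      case False
      then have F: "F x = ennreal (norm (f x))" "0 < norm (f x)"
        by (cases "F x"; simp add: f_def)+
      \<comment> \<open>Half of a finite positive supremum is exceeded by some term.\<close>
      then have "ennreal (norm (f x) / 2) < F x"
        by (simp add: ennreal_less_iff)
      then obtain k where k: "ennreal (norm (f x) / 2) < ennreal (c k) * indicator (E k) x"
        by (auto simp: F_def less_SUP_iff)
      then have "x \<in> E k"
        by (cases "x \<in> E k") auto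
      with k have "norm (f x) \<le> 2 * c k"
        by (simp add: ennreal_less_iff)
      then have "ennreal (\<Phi> (norm (f x))) \<le> ennreal (\<Phi> (2 * c k)) * indicator (E k) x"
        using \<open>x \<in> E k\<close> by (simp add: \<Phi>_mono ennreal_leI)
      also have "\<dots> \<le> (\<Sum>k. ennreal (\<Phi> (2 * c k)) * indicator (E k) x)"
        by (rule ennreal_le_suminf)
      finally show ?thesis .
    qed
    then have "(\<integral>\<^sup>+x. ennreal (\<Phi> (norm (f x))) \<partial>surface)
      \<le> (\<integral>\<^sup>+x. (\<Sum>k. ennreal (\<Phi> (2 * c k)) * indicator (E k) x) \<partial>surface)"
      by (intro nn_integral_mono)
    also have "\<dots> = (\<Sum>k. ennreal (\<Phi> (2 * c k)) * emeasure surface (E k))"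
      by (simp add: nn_integral_suminf nn_integral_cmult_indicator)
    also have "\<dots> \<le> (\<Sum>k. ennreal (2 * S * ((1 / 2) ^ k * ((real k)\<^sup>2 + 2) powr \<beta>)))"
    proof (intro suminf_le)
      fix k
      \<comment> \<open>The logarithm is at most \<open>k\<^sup>2 + 2\<close>, since
        \<open>exp 1 + 2 * c k\<close> is at most \<open>3 + 2 * exp (k\<^sup>2)\<close>, hence at
        most \<open>5 * exp (k\<^sup>2)\<close>, and \<open>5 \<le> exp 2\<close>.\<close>
      have "c k \<le> exp ((real k)\<^sup>2)"
        by (simp add: c_def power_le_one)
      moreover have "exp 1 \<le> (3::real)" "1 \<le> exp ((real k)\<^sup>2)"
        using exp_le by auto
      moreover have "5 \<le> exp (2::real)"
        using exp_ge_one_plus_x_over_n_power_n[of 4 2] by (simp add: power_divide)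
      then have "5 * exp ((real k)\<^sup>2) \<le> exp 2 * exp ((real k)\<^sup>2)"
        by (intro mult_right_mono) auto
      ultimately have "exp 1 + 2 * c k \<le> exp 2 * exp ((real k)\<^sup>2)"
        by linarith
      then have "exp 1 + 2 * c k \<le> exp ((real k)\<^sup>2 + 2)"
        by (simp add: exp_add mult.commute)
      moreover have ge1: "1 \<le> exp 1 + 2 * c k"
        using c_nonneg[of k] exp_ge_add_one_self[of 1] by linarith
      ultimately have "ln (exp 1 + 2 * c k) \<le> ln (exp ((real k)\<^sup>2 + 2))"
        by (subst ln_le_cancel_iff) auto
      then have "ln (exp 1 + 2 * c k) \<le> (real k)\<^sup>2 + 2"
        by simp
      with ge1 have "\<Phi> (2 * c k) \<le> 2 * c k * ((real k)\<^sup>2 + 2) powr \<beta>"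
        using c_nonneg[of k] \<open>0 < \<beta>\<close> unfolding \<Phi>_def by (intro mult_left_mono powr_mono2) auto
      then have "\<Phi> (2 * c k) * (exp (- (real k)\<^sup>2) * S) \<le> 2 * c k * ((real k)\<^sup>2 + 2) powr \<beta> * (exp (- (real k)\<^sup>2) * S)"
        using S by (intro mult_right_mono) auto
      also have "\<dots> = 2 * S * ((1 / 2) ^ k * ((real k)\<^sup>2 + 2) powr \<beta>)"
        by (simp add: c_def exp_minus)
      finally show "ennreal (\<Phi> (2 * c k)) * emeasure surface (E k)
          \<le> ennreal (2 * S * ((1 / 2) ^ k * ((real k)\<^sup>2 + 2) powr \<beta>))"
        using S \<Phi>_mono[of 0 "2 * c k"] c_nonneg[of k]
        by (simp add: surface.emeasure_eq_measure mE \<Phi>_def ennreal_leI flip: ennreal_mult)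
    qed auto
    also have "\<dots> < \<infinity>"
    proof -
      \<comment> \<open>Any ratio strictly between 1/2 and 1 absorbs the polynomial factor.\<close>
      have "(\<lambda>k. (1 / 2) ^ k * ((real k)\<^sup>2 + 2) powr \<beta>) \<in> O(\<lambda>k. (3 / 4) ^ k)"
        by real_asymp
      then have "summable (\<lambda>k. (1 / 2) ^ k * ((real k)\<^sup>2 + 2) powr \<beta>)"
        by (rule summable_comparison_test_bigo[rotated]) (simp add: summable_geometric)
      then show ?thesis
        using S by (subst suminf_ennreal2) (auto intro!: summable_mult)
    qed
    finally show "f \<in> LlogL \<beta>"
      by (simp add: LlogL_def \<Phi>_def)
  next
    fix \<nu> :: real and q :: ennreal assume \<nu>: "- 1 < \<nu>" and q: "1 < q"
    show "f \<notin> block_space q \<nu>"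
    proof
      assume f: "f \<in> block_space q \<nu>"
      define \<gamma> where "\<gamma> = enn2real (inverse (conj_exponent q))"
      have \<gamma>: "0 < \<gamma>"
        unfolding \<gamma>_def by (rule inverse_conj_exponent_pos[OF q])
      obtain C where C: "0 \<le> C" "\<forall>E \<theta> \<kappa>. E \<in> sets surface \<longrightarrow> 0 < \<theta> \<longrightarrow> 0 < \<kappa> \<longrightarrow> \<kappa> < 1 \<longrightarrow>
        (\<forall>M. is_cap M \<longrightarrow> \<kappa> \<le> measure surface M \<longrightarrow> measure surface (E \<inter> M) \<le> \<theta> * measure surface M) \<longrightarrow>
        (\<integral>\<^sup>+x\<in>E. ennreal (norm (f x)) \<partial>surface)
          \<le> ennreal (C * (\<theta> powr \<gamma> + ln (1 / \<kappa>) powr (- (1 + \<nu>))))"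
        unfolding \<gamma>_def using block_space_set_nn_integral_le[OF q \<nu> f] by blast
      \<comment> \<open>The bracket for \<open>E k\<close>, divided by the factor
        \<open>(1 / 2) ^ k\<close> of the mass there; membership would keep \<open>C * b k\<close>
        above the constant \<open>S\<close>.\<close>
      define b where "b k = 2 ^ k * ((2 * exp (- (real k)\<^sup>2)) powr \<gamma> + exp ((real k)\<^sup>2) powr (- (1 + \<nu>)))" for k
      have "S \<le> C * b k" for k
      proof -
        have "ennreal ((1 / 2) ^ k * S) = (\<integral>\<^sup>+x. ennreal (c k) * indicator (E k) x \<partial>surface)"
          by (simp add: nn_integral_cmult_indicator cE)
        also have "\<dots> \<le> (\<integral>\<^sup>+x\<in>E k. ennreal (norm (f x)) \<partial>surface)"
        proof (rule nn_integral_mono_AE)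
          show "AE x in surface. ennreal (c k) * indicator (E k) x \<le> ennreal (norm (f x)) * indicator (E k) x"
            using F_eq
          proof eventually_elim
            case (elim x)
            then show ?case using c_le_F[of k x] by (auto simp: indicator_def)
          qed
        qed
        also have "\<dots> \<le> ennreal (C * ((2 * exp (- (real k)\<^sup>2)) powr \<gamma>
            + ln (1 / exp (- exp ((real k)\<^sup>2))) powr (- (1 + \<nu>))))"
          using spread by (intro C(2)[rule_format]) auto
        finally have "(1 / 2) ^ k * S \<le> C * ((2 * exp (- (real k)\<^sup>2)) powr \<gamma> + exp ((real k)\<^sup>2) powr (- (1 + \<nu>)))"
          using C(1) by (simp add: exp_minus ln_inverse inverse_eq_divide)
        then have "2 ^ k * ((1 / 2) ^ k * S) \<le> 2 ^ k * (C * ((2 * exp (- (real k)\<^sup>2)) powr \<gamma> + exp ((real k)\<^sup>2) powr (- (1 + \<nu>))))"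
          by (intro mult_left_mono) auto
        then show ?thesis
          by (simp add: b_def power_divide mult_ac)
      qed
      moreover have "b \<longlonglongrightarrow> 0"
      proof -
        \<comment> \<open>Both summands of \<open>b k\<close> have this form, with
          \<open>\<delta>\<close> equal to \<open>\<gamma>\<close> and to \<open>1 + \<nu>\<close>;
          the quadratic term beats the growth of \<open>2 ^ k\<close>.\<close>
        have *: "(\<lambda>k. exp (A + real k * ln 2 - \<delta> * (real k)\<^sup>2)) \<longlonglongrightarrow> 0" if "0 < \<delta>" for A \<delta> :: real
          using that by real_asymp
        have "2 ^ k = exp (real k * ln 2)" for k :: nat
          by (simp add: exp_of_nat_mult)
        then have "b k = exp (\<gamma> * ln 2 + real k * ln 2 - \<gamma> * (real k)\<^sup>2) + exp (0 + real k * ln 2 - (1 + \<nu>) * (real k)\<^sup>2)" for k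
          by (simp add: b_def powr_def ln_mult algebra_simps flip: exp_add)
        then have "b = (\<lambda>k. exp (\<gamma> * ln 2 + real k * ln 2 - \<gamma> * (real k)\<^sup>2) + exp (0 + real k * ln 2 - (1 + \<nu>) * (real k)\<^sup>2))"
          by (rule ext)
        then show ?thesis
          using tendsto_add[OF *[OF \<gamma>] *[of "1 + \<nu>" 0]] \<nu> by simp
      qed
      then have "(\<lambda>k. C * b k) \<longlonglongrightarrow> C * 0"
        by (intro tendsto_mult_left)
      ultimately have "S \<le> C * 0"
        by (intro LIMSEQ_le_const) auto
      with S show False by simp
    qed
  qed
qed

theorem theoremC:
  assumes "CARD('n::finite) \<ge> 2"
  shows "(\<Inter>\<beta>\<in>{0<..}. LlogL \<beta> :: (real ^ 'n \<Rightarrow> complex) set)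
           - (\<Union>\<nu>\<in>{-1<..}. \<Union>q\<in>{1<..}. block_space q \<nu>) \<noteq> {}"
proof -
  have "2 \<le> DIM(real ^ 'n)"
    using assms by simp
  then show ?thesis
    by (rule LlogL_minus_block_space_nonempty) blast
qed

end
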